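(* Let $n\ge 3$, $C\ge 1$ and let $m\ge 100$ be an integer. Let $\mathcal{G}_m$ be the Dirichlet Green's function in the unit ball $B(0,1)\subset\mathbb{R}^n$ of the operator $L_m u=-\nabla\cdot(\nabla u)+\mathcal{B}_m\cdot\nabla u$, where $\mathcal{B}_m(x)=-\frac{C}{1-|x|}\frac{x}{|x|}$ for $0<|x|\le 1-\frac1m$ and $\mathcal{B}_m(x)=-Cm\frac{x}{|x|}$ for $1-\frac1m<|x|<1$. Then $\mathcal{G}_m(x,0)$ depends only on the radial variable $|x|$: for all $x,x'\in B(0,1)\setminus\{0\}$ with $|x|=|x'|$ one has $\mathcal{G}_m(x,0)=\mathcal{G}_m(x',0)$.
   Context: Here $B(0,1)$ is the open unit ball of $\mathbb{R}^n$ centered at the origin. For each $m$ the drift $\mathcal{B}_m$ is bounded. The Green's function associated with $L_m$ is the unique non-negative function $\mathcal{G}_m:B(0,1)\times B(0,1)\to\mathbb{R}\cup\{\infty\}$ such that, for every $y\in B(0,1)$: (1) for all $s>0$, $\mathcal{G}_m(\cdot,y)\in C(B(0,1)\setminus B(y,s))\cap W^{1,2}(B(0,1)\setminus B(y,s))\cap W^{1,1}(B(0,1))$; (2) $\int_{B(0,1)}\big(\nabla_x\mathcal{G}_m(x,y)\cdot\nabla\phi(x)+\mathcal{B}_m(x)\cdot\nabla_x\mathcal{G}_m(x,y)\,\phi(x)\big)\,dx=\phi(y)$ for all $\phi\in C_c^\infty(B(0,1))$; (3) $\mathcal{G}_m(\cdot,y)$ vanishes on the boundary $\partial B(0,1)$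 (Dirichlet condition, in the sense of zero trace). The second argument $y$ is the pole. *)

theory Defs
  imports "HOL-Analysis.Analysis"
begin

definition grad :: "(real^'n \<Rightarrow> real) \<Rightarrow> real^'n \<Rightarrow> real^'n" where
  "grad f x = (\<chi> i. frechet_derivative f (at x) (axis i 1))"

fun Ck :: "nat \<Rightarrow> (real^'n \<Rightarrow> real) \<Rightarrow> bool" where
  "Ck 0 f = continuous_on UNIV f"
| "Ck (Suc k) f = ((\<forall>x. f differentiable (at x)) \<and> (\<forall>i. Ck k (\<lambda>x. grad f x $ i)))"

definition smooth :: "(real^'n \<Rightarrow> real) \<Rightarrow> bool" where
  "smooth f \<longleftrightarrow> (\<forall>k. Ck k f)"

(* C_c^\<infinity>(\<Omega>) for open \<Omega>; elements are extended by zero to the whole space. *)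
definition test_functions :: "(real^'n) set \<Rightarrow> (real^'n \<Rightarrow> real) set" where
  "test_functions \<Omega> =
     {\<phi>. smooth \<phi> \<and> compact (closure {x. \<phi> x \<noteq> 0}) \<and> closure {x. \<phi> x \<noteq> 0} \<subseteq> \<Omega>}"

definition locally_integrable_on ::
    "(real^'n \<Rightarrow> 'b::euclidean_space) \<Rightarrow> (real^'n) set \<Rightarrow> bool" where
  "locally_integrable_on f \<Omega> \<longleftrightarrow>
     (\<forall>K. compact K \<and> K \<subseteq> \<Omega> \<longrightarrow> set_integrable lebesgue K f)"

definition has_weak_gradient ::
    "(real^'n \<Rightarrow> real) \<Rightarrow> (real^'n \<Rightarrow> real^'n) \<Rightarrow> (real^'n) set \<Rightarrow> bool" where
  "has_weak_gradient u g \<Omega> \<longleftrightarrow>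
     locally_integrable_on u \<Omega> \<and> locally_integrable_on g \<Omega> \<and>
     (\<forall>\<phi>\<in>test_functions \<Omega>.
        (LINT x:\<Omega>|lebesgue. u x *\<^sub>R grad \<phi> x) = - (LINT x:\<Omega>|lebesgue. \<phi> x *\<^sub>R g x))"

definition Lp :: "real \<Rightarrow> (real^'n) set \<Rightarrow> (real^'n \<Rightarrow> 'b::euclidean_space) set" where
  "Lp p \<Omega> = {f. set_borel_measurable lebesgue \<Omega> f \<and>
                set_integrable lebesgue \<Omega> (\<lambda>x. norm (f x) powr p)}"

definition W1 :: "real \<Rightarrow> (real^'n) set \<Rightarrow> (real^'n \<Rightarrow> real) set" where
  "W1 p \<Omega> = {u. u \<in> Lp p \<Omega> \<and> (\<exists>g. has_weak_gradient u g \<Omega> \<and> g \<in> Lp p \<Omega>)}"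

(* Surface measure on the unit sphere: the surface measure of A is n times the volume of the
   part {x. 0 < norm x < 1, x / norm x \<in> A} of the cone over A. Note sgn x = x / norm x. *)
definition sphere_measure :: "(real^'n) measure" where
  "sphere_measure =
     scale_measure (of_nat CARD('n)) (distr (restrict_space lborel (ball 0 1)) borel sgn)"

(* The trace operator W^{1,1}(B(0,1)) \<rightarrow> L^1(\<partial>B(0,1)): the continuous extension of restriction to
   the sphere, from functions smooth up to the boundary. *)
definition has_trace :: "(real^'n \<Rightarrow> real) \<Rightarrow> (real^'n \<Rightarrow> real) \<Rightarrow> bool" where
  "has_trace u h \<longleftrightarrow>
     integrable sphere_measure h \<and> u \<in> Lp 1 (ball 0 1) \<and>
     (\<exists>g. has_weak_gradient u g (ball 0 1) \<and> g \<in> Lp 1 (ball 0 1) \<and>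
       (\<exists>v. (\<forall>k. smooth (v k)) \<and>
         (\<lambda>k. LINT x:ball 0 1|lebesgue. \<bar>v k x - u x\<bar>) \<longlonglongrightarrow> 0 \<and>
         (\<lambda>k. LINT x:ball 0 1|lebesgue. norm (grad (v k) x - g x)) \<longlonglongrightarrow> 0 \<and>
         (\<lambda>k. LINT x|sphere_measure. \<bar>v k x - h x\<bar>) \<longlonglongrightarrow> 0))"

(* The conditions on u = G(.,y) for a fixed pole y. W^{1,2}(B(0,1) - B(y,s)) is taken over the
   interior of the domain. Weak gradients are unique a.e., so the choice of g is immaterial. *)
definition greens_at_pole ::
    "(real^'n \<Rightarrow> real^'n) \<Rightarrow> real^'n \<Rightarrow> (real^'n \<Rightarrow> real) \<Rightarrow> bool" where
  "greens_at_pole b y u \<longleftrightarrow>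
     (\<forall>s>0. continuous_on (ball 0 1 - ball y s) u \<and> u \<in> W1 2 (ball 0 1 - cball y s)) \<and>
     u \<in> W1 1 (ball 0 1) \<and>
     (\<exists>g. has_weak_gradient u g (ball 0 1) \<and> g \<in> Lp 1 (ball 0 1) \<and>
        (\<forall>\<phi>\<in>test_functions (ball 0 1).
           (LINT x:ball 0 1|lebesgue. g x \<bullet> grad \<phi> x + (b x \<bullet> g x) * \<phi> x) = \<phi> y)) \<and>
     has_trace u (\<lambda>x. 0)"

(* Membership in C(B(0,1) - B(y,s)) includes finiteness off the pole; real_of_ereal sends a
   possible value \<infinity> at the pole itself to 0, which affects a null set only. *)
definition greens_conditions ::
    "(real^'n \<Rightarrow> real^'n) \<Rightarrow> (real^'n \<Rightarrow> real^'n \<Rightarrow> ereal) \<Rightarrow> bool" where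
  "greens_conditions b G \<longleftrightarrow>
     (\<forall>x\<in>ball 0 1. \<forall>y\<in>ball 0 1. 0 \<le> G x y \<and> (x \<noteq> y \<longrightarrow> G x y \<noteq> \<infinity>)) \<and>
     (\<forall>y\<in>ball 0 1. greens_at_pole b y (\<lambda>x. real_of_ereal (G x y)))"

(* The Dirichlet Green's function of -\<Delta>u + b \<bullet> \<nabla>u in the unit ball is the unique function with the
   above properties. These do not constrain G on the diagonal, so uniqueness is off the diagonal. *)
definition is_greens_function ::
    "(real^'n \<Rightarrow> real^'n) \<Rightarrow> (real^'n \<Rightarrow> real^'n \<Rightarrow> ereal) \<Rightarrow> bool" where
  "is_greens_function b G \<longleftrightarrow>
     greens_conditions b G \<and>
     (\<forall>H. greens_conditions b H \<longrightarrow>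
        (\<forall>x\<in>ball 0 1. \<forall>y\<in>ball 0 1. x \<noteq> y \<longrightarrow> H x y = G x y))"

(* The value at the origin is irrelevant (here 0, by division by zero). *)
definition drift :: "real \<Rightarrow> nat \<Rightarrow> real^'n \<Rightarrow> real^'n" where
  "drift C m x =
     (if norm x \<le> 1 - 1 / real m
      then - (C / (1 - norm x)) *\<^sub>R (x /\<^sub>R norm x)
      else - (C * real m) *\<^sub>R (x /\<^sub>R norm x))"

end

theory Submission
  imports Defs
begin

text \<open>
  The operator is invariant under the orthogonal group: the Laplacian is, and the drift is a radial
  vector field, so that \<open>b(T x) = T(b(x))\<close> for every orthogonal \<open>T\<close>. Hence \<open>(x, y) \<mapsto> G(T x, T y)\<close> is again
  a Green's function of the same operator, and by uniqueness it agrees with \<open>G\<close> off the diagonal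
  (\<open>greens_function_orthogonal\<close>). The pole 0 is fixed by \<open>T\<close>, which gives \<open>G(T x, 0) = G(x, 0)\<close>; and the
  orthogonal group acts transitively on each sphere around the origin.

  What has to be checked is that every ingredient of the definition of a Green's function is
  compatible with an orthogonal change of variables. Two facts carry this. Lebesgue measure is
  invariant (\<open>lborel_distr_orthogonal\<close>), and with it the surface measure of the sphere, which is defined
  by volumes of cones. And gradients transform by the chain rule \<open>\<nabla>(f \<circ> T) = T\<inverse> (\<nabla>f \<circ> T)\<close>, first for
  smooth functions (\<open>grad_compose_orthogonal\<close>) and then, since \<open>\<phi> \<mapsto> \<phi> \<circ> T\<close> is a bijection between test
  functions on \<open>\<Omega>\<close> and on \<open>T -` \<Omega>\<close>, for weak gradients (\<open>has_weak_gradient_orthogonal\<close>).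
\<close>

section \<open>Orthogonal transformations\<close>

lemma orthogonal_vimage_ball:
  fixes T :: "real^'n \<Rightarrow> real^'n"
  assumes T: "orthogonal_transformation T"
  shows "T -` ball (T y) s = ball y s" "T -` cball (T y) s = cball y s"
  using T by (auto simp: orthogonal_transformation_isometry)

lemma orthogonal_inv:
  fixes T :: "real^'n \<Rightarrow> real^'n"
  assumes "orthogonal_transformation T"
  shows "T (inv T x) = x" "inv T (T x) = x"
  using assms
  by (simp_all add: orthogonal_transformation_inj orthogonal_transformation_surj surj_f_inv_f)

lemma orthogonal_inner_shift:
  fixes T :: "real^'n \<Rightarrow> real^'n"
  assumes T: "orthogonal_transformation T"
  shows "x \<bullet> T y = inv T x \<bullet> y"
  by (metis T orthogonal_inv(1) orthogonal_transformation_def)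

lemma orthogonal_bounded_linear:
  fixes T :: "real^'n \<Rightarrow> real^'n"
  assumes "orthogonal_transformation T"
  shows "bounded_linear T"
  using orthogonal_transformation_linear[OF assms] by (simp add: linear_conv_bounded_linear)

lemma orthogonal_borel_measurable:
  fixes T :: "real^'n \<Rightarrow> real^'n"
  assumes "orthogonal_transformation T"
  shows "T \<in> borel_measurable borel"
  using assms
  by (intro borel_measurable_continuous_onI linear_continuous_on orthogonal_bounded_linear)

section \<open>Invariance of Lebesgue measure and surface measure\<close>

text \<open>
  Evaluate in both orders the integral of \<open>1\<^sub>D(x) 1\<^sub>B(T x + y)\<close> over all pairs \<open>(x, y)\<close>, where \<open>D\<close> is the
  unit ball. Integrating over \<open>y\<close> first gives \<open>|D| |B|\<close> by translation invariance. For the other order,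
  shift \<open>x\<close> by \<open>T\<inverse> y\<close> and then integrate \<open>1\<^sub>D(x - T\<inverse> y) = 1\<^sub>D(y - T x)\<close> over \<open>y\<close>, which gives
  \<open>|D| |T\<inverse> B|\<close>. The ball is chosen because \<open>T\<close> preserves the norm, and so \<open>1\<^sub>D\<close>. Since \<open>0 < |D| < \<infinity>\<close>, the factor \<open>|D|\<close> cancels.
\<close>

lemma lborel_distr_orthogonal:
  fixes T :: "real^'n \<Rightarrow> real^'n"
  assumes T: "orthogonal_transformation T"
  shows "distr lborel borel T = lborel"
proof (rule measure_eqI)
  fix B assume "B \<in> sets (distr lborel borel T)"
  then have B [measurable]: "B \<in> sets borel" by simp
  have [measurable]: "T \<in> borel_measurable borel" "inv T \<in> borel_measurable borel"
    using T orthogonal_transformation_inv[OF T] by (auto intro: orthogonal_borel_measurable)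
  define D :: "(real^'n) set" where "D = ball 0 1"
  have D [measurable]: "D \<in> sets borel" by (simp add: D_def)
  have shift: "(\<integral>\<^sup>+x. f x \<partial>lborel) = (\<integral>\<^sup>+x. f (a + x) \<partial>lborel)"
    if [measurable]: "f \<in> borel_measurable borel" for f and a :: "real^'n"
    by (subst lborel_distr_plus[of a, symmetric]) (simp add: nn_integral_distr)
  have sub: "T (x - y) = T x - T y" for x y
    using T by (simp add: linear_diff orthogonal_transformation_linear)
  have add: "T (x + y) = T x + T y" for x y
    using T by (simp add: linear_add orthogonal_transformation_linear)
  \<comment> \<open>This is the symmetry of the ball that exchanges the roles of \<open>x\<close> and \<open>y\<close>.\<close>
  have nrm: "norm (x - inv T y) = norm (y - T x)" for x y
  proof -
    have "norm (x - inv T y) = norm (T (x - inv T y))"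
      by (simp only: orthogonal_transformation_norm[OF T])
    then show ?thesis by (simp add: sub orthogonal_inv[OF T] norm_minus_commute)
  qed
  have ind: "(\<lambda>p. indicator A (f p) :: ennreal) \<in> borel_measurable (lborel \<Otimes>\<^sub>M lborel)"
    if "A \<in> sets borel" "f \<in> lborel \<Otimes>\<^sub>M lborel \<rightarrow>\<^sub>M borel"
    for A :: "(real^'n) set" and f :: "(real^'n) \<times> (real^'n) \<Rightarrow> real^'n"
    using that by (intro measurable_compose[OF that(2)]) simp
  have meas1: "(\<lambda>(x, y). indicator D x * indicator B (T x + y) :: ennreal)
      \<in> borel_measurable (lborel \<Otimes>\<^sub>M lborel)"
    unfolding case_prod_beta by (intro borel_measurable_times_ennreal ind D B) measurable
  have meas2: "(\<lambda>(x, y). indicator D (x - inv T y) * indicator B (T x) :: ennreal)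
      \<in> borel_measurable (lborel \<Otimes>\<^sub>M lborel)"
    unfolding case_prod_beta by (intro borel_measurable_times_ennreal ind D B) measurable
  have "emeasure lborel D * emeasure lborel B
      = (\<integral>\<^sup>+x. indicator D x * (\<integral>\<^sup>+y. indicator B y \<partial>lborel) \<partial>lborel)"
    by (simp add: nn_integral_multc)
  also have "\<dots> = (\<integral>\<^sup>+x. (\<integral>\<^sup>+y. indicator D x * indicator B (T x + y) \<partial>lborel) \<partial>lborel)"
  proof (rule nn_integral_cong)
    fix x
    have "(\<integral>\<^sup>+y. indicator B y \<partial>lborel) = (\<integral>\<^sup>+y. indicator B (T x + y) \<partial>lborel)"
      by (rule shift) simp
    then show "indicator D x * (\<integral>\<^sup>+y. indicator B y \<partial>lborel)
        = (\<integral>\<^sup>+y. indicator D x * indicator B (T x + y) \<partial>lborel)"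
      by (simp add: nn_integral_cmult)
  qed
  also have "\<dots> = (\<integral>\<^sup>+y. (\<integral>\<^sup>+x. indicator D x * indicator B (T x + y) \<partial>lborel) \<partial>lborel)"
    using lborel_pair.Fubini'[OF meas1] by simp
  also have "\<dots> = (\<integral>\<^sup>+y. (\<integral>\<^sup>+x. indicator D (x - inv T y) * indicator B (T x) \<partial>lborel) \<partial>lborel)"
  proof (rule nn_integral_cong)
    fix y
    show "(\<integral>\<^sup>+x. indicator D x * indicator B (T x + y) \<partial>lborel)
        = (\<integral>\<^sup>+x. indicator D (x - inv T y) * indicator B (T x) \<partial>lborel)"
      by (subst (2) shift[where a = "inv T y"]) (simp_all add: add orthogonal_inv[OF T] add.commute)
  qed
  also have "\<dots> = (\<integral>\<^sup>+x. (\<integral>\<^sup>+y. indicator D (x - inv T y) * indicator B (T x) \<partial>lborel) \<partial>lborel)"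
    using lborel_pair.Fubini'[OF meas2] by simp
  also have "\<dots> = (\<integral>\<^sup>+x. (\<integral>\<^sup>+y. indicator D (y - T x) * indicator B (T x) \<partial>lborel) \<partial>lborel)"
    by (simp add: indicator_def D_def nrm)
  also have "\<dots> = (\<integral>\<^sup>+x. emeasure lborel D * indicator B (T x) \<partial>lborel)"
  proof (rule nn_integral_cong)
    fix x
    have "(\<integral>\<^sup>+y. indicator D (y - T x) * indicator B (T x) \<partial>lborel)
        = (\<integral>\<^sup>+y. indicator D (y - T x) \<partial>lborel) * indicator B (T x)"
      by (rule nn_integral_multc) measurable
    also have "(\<integral>\<^sup>+y. indicator D (y - T x) \<partial>lborel) = emeasure lborel D"
      by (subst shift[where a = "T x"]) simp_all
    finally show "(\<integral>\<^sup>+y. indicator D (y - T x) * indicator B (T x) \<partial>lborel)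
        = emeasure lborel D * indicator B (T x)" .
  qed
  also have "\<dots> = emeasure lborel D * (\<integral>\<^sup>+x. indicator B (T x) \<partial>lborel)"
    by (rule nn_integral_cmult) measurable
  also have "(\<integral>\<^sup>+x. indicator B (T x) \<partial>lborel) = emeasure (distr lborel borel T) B"
    by (subst nn_integral_distr[of T lborel borel "indicator B", symmetric]) simp_all
  finally have eq: "emeasure lborel D * emeasure lborel B
      = emeasure lborel D * emeasure (distr lborel borel T) B" .
  have "emeasure lborel D \<noteq> 0"
    using open_not_negligible[of D] negligible_iff_emeasure0[of D] by (simp add: D_def)
  moreover have "emeasure lborel D < \<infinity>"
    unfolding D_def by (rule emeasure_lborel_ball_finite)
  ultimately show "emeasure (distr lborel borel T) B = emeasure lborel B"
    using eq by (metis ennreal_mult_cancel_left infinity_ennreal_def less_irrefl)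
qed simp

lemma
  fixes T :: "real^'n \<Rightarrow> real^'n"
  assumes T: "orthogonal_transformation T"
  shows lebesgue_measurable_orthogonal: "T \<in> lebesgue \<rightarrow>\<^sub>M lebesgue"
    and lebesgue_distr_orthogonal: "distr lebesgue lebesgue T = lebesgue"
proof -
  have T_borel: "T \<in> lborel \<rightarrow>\<^sub>M lborel"
    using orthogonal_borel_measurable[OF T] by simp
  have eq: "distr lebesgue lborel T = lborel"
    using lborel_distr_orthogonal[OF T] distr_completion[OF T_borel] by (simp cong: distr_cong)
  show "T \<in> lebesgue \<rightarrow>\<^sub>M lebesgue"
    using T_borel by (simp add: completion.measurable_completion2 eq measurable_completion)
  show "distr lebesgue lebesgue T = lebesgue"
    using completion.completion_distr_eq[of T lborel lborel] T_borel
    by (simp add: eq measurable_completion)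
qed

text \<open>
  A measure preserving map with a measurable right inverse allows a change of variables without any measurability
  hypothesis on \<open>f\<close>: if \<open>f\<close> is not measurable, neither is \<open>f \<circ> T\<close>, and both integrals have their default
  value 0. The weak formulations below contain integrals whose integrability is not part of the
  conditions, so this generality matters.
\<close>

lemma
  fixes f :: "'a \<Rightarrow> 'b::{banach, second_countable_topology}"
  assumes T: "T \<in> M \<rightarrow>\<^sub>M M" and S: "S \<in> M \<rightarrow>\<^sub>M M" and TS: "\<And>x. T (S x) = x"
    and inv: "distr M M T = M"
  shows measure_preserving_measurable_iff:
      "(\<lambda>x. f (T x)) \<in> borel_measurable M \<longleftrightarrow> f \<in> borel_measurable M"
    and measure_preserving_integrable_iff:
      "integrable M (\<lambda>x. f (T x)) \<longleftrightarrow> integrable M f"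
    and measure_preserving_integral:
      "(LINT x|M. f (T x)) = (LINT x|M. f x)"
proof -
  show meas: "(\<lambda>x. f (T x)) \<in> borel_measurable M \<longleftrightarrow> f \<in> borel_measurable M"
  proof
    assume "(\<lambda>x. f (T x)) \<in> borel_measurable M"
    from measurable_compose[OF S this] show "f \<in> borel_measurable M" by (simp add: TS)
  qed (rule measurable_compose[OF T])
  show int: "integrable M (\<lambda>x. f (T x)) \<longleftrightarrow> integrable M f"
    using integrable_distr_eq[OF T, of f] meas by (metis borel_measurable_integrable inv)
  show "(LINT x|M. f (T x)) = (LINT x|M. f x)"
  proof (cases "f \<in> borel_measurable M")
    case True
    then show ?thesis using integral_distr[OF T, of f] by (simp add: inv)
  next
    case False
    then have "\<not> integrable M f" by auto
    with int show ?thesis by (simp add: not_integrable_integral_eq)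
  qed
qed

lemma
  fixes T :: "real^'n \<Rightarrow> real^'n" and f :: "real^'n \<Rightarrow> 'b::euclidean_space"
  assumes T: "orthogonal_transformation T"
  shows set_borel_measurable_orthogonal:
      "set_borel_measurable lebesgue (T -` A) (\<lambda>x. f (T x)) \<longleftrightarrow> set_borel_measurable lebesgue A f"
    and set_integrable_orthogonal:
      "set_integrable lebesgue (T -` A) (\<lambda>x. f (T x)) \<longleftrightarrow> set_integrable lebesgue A f"
    and set_integral_orthogonal:
      "(LINT x:T -` A|lebesgue. f (T x)) = (LINT x:A|lebesgue. f x)"
proof -
  note pres = lebesgue_measurable_orthogonal[OF T]
    lebesgue_measurable_orthogonal[OF orthogonal_transformation_inv[OF T]]
    orthogonal_inv(1)[OF T] lebesgue_distr_orthogonal[OF T]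
  let ?f = "\<lambda>x. indicat_real A x *\<^sub>R f x"
  have ind: "indicat_real (T -` A) x = indicator A (T x)" for x
    by (simp add: indicator_def)
  show "set_borel_measurable lebesgue (T -` A) (\<lambda>x. f (T x)) \<longleftrightarrow> set_borel_measurable lebesgue A f"
    using measure_preserving_measurable_iff[OF pres, of ?f] by (simp add: set_borel_measurable_def ind)
  show "set_integrable lebesgue (T -` A) (\<lambda>x. f (T x)) \<longleftrightarrow> set_integrable lebesgue A f"
    using measure_preserving_integrable_iff[OF pres, of ?f] by (simp add: set_integrable_def ind)
  show "(LINT x:T -` A|lebesgue. f (T x)) = (LINT x:A|lebesgue. f x)"
    using measure_preserving_integral[OF pres, of ?f] by (simp add: set_lebesgue_integral_def ind)
qed

text \<open>
  The map \<open>sgn\<close> commutes with \<open>T\<close>, so \<open>T\<close> permutes the cones that define the surface measure.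
\<close>

lemma sphere_measure_orthogonal:
  fixes T :: "real^'n \<Rightarrow> real^'n"
  assumes T: "orthogonal_transformation T"
  shows "distr sphere_measure sphere_measure T = sphere_measure"
proof (rule measure_eqI)
  fix A :: "(real^'n) set" assume "A \<in> sets (distr sphere_measure sphere_measure T)"
  then have A: "A \<in> sets borel" by (simp add: sphere_measure_def)
  have Tm [measurable]: "T \<in> borel_measurable borel" by (rule orthogonal_borel_measurable[OF T])
  note sgn_m = borel_measurable_sgn[where 'a = "real^'n"]
  have em: "emeasure sphere_measure B
      = of_nat CARD('n) * emeasure lborel (sgn -` B \<inter> ball 0 1)" if "B \<in> sets borel" for B :: "(real^'n) set"
  proof -
    have "emeasure (restrict_space lborel (ball 0 1)) (sgn -` B \<inter> ball 0 1)
        = emeasure lborel (sgn -` B \<inter> ball 0 1)"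
      by (rule emeasure_restrict_space) auto
    moreover have "sgn \<in> restrict_space lborel (ball 0 1) \<rightarrow>\<^sub>M (borel :: (real^'n) measure)"
      by (intro measurable_restrict_space1) simp
    ultimately show ?thesis
      using that by (simp add: sphere_measure_def emeasure_distr space_restrict_space)
  qed
  have sgnT: "sgn (T x) = T (sgn x)" for x
    using T by (simp add: sgn_div_norm orthogonal_transformation_norm
        linear_scale[OF orthogonal_transformation_linear[OF T]])
  have TA: "T -` A \<in> sets borel"
    using measurable_sets[OF Tm A] by simp
  have cone: "sgn -` A \<inter> ball 0 1 \<in> sets borel"
    using measurable_sets[OF sgn_m A] by (simp add: sets.Int)
  have "emeasure (distr sphere_measure sphere_measure T) A = emeasure sphere_measure (T -` A)"
    using A by (subst emeasure_distr) (auto simp: sphere_measure_def space_scale_measure measurable_def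
        sets_scale_measure measurable_sets_borel[OF Tm])
  also have "\<dots> = of_nat CARD('n) * emeasure lborel (sgn -` (T -` A) \<inter> ball 0 1)"
    by (rule em[OF TA])
  also have "sgn -` (T -` A) \<inter> ball 0 1 = T -` (sgn -` A \<inter> ball 0 1)"
    using T by (auto simp: sgnT orthogonal_transformation_norm)
  also have "emeasure lborel \<dots> = emeasure (distr lborel borel T) (sgn -` A \<inter> ball 0 1)"
    using cone by (subst emeasure_distr) auto
  also have "\<dots> = emeasure lborel (sgn -` A \<inter> ball 0 1)"
    by (simp only: lborel_distr_orthogonal[OF T])
  also have "of_nat CARD('n) * \<dots> = emeasure sphere_measure A"
    by (rule em[OF A, symmetric])
  finally show "emeasure (distr sphere_measure sphere_measure T) A = emeasure sphere_measure A" .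
qed simp

lemma
  fixes T :: "real^'n \<Rightarrow> real^'n" and f :: "real^'n \<Rightarrow> real"
  assumes T: "orthogonal_transformation T"
  shows sphere_integrable_orthogonal:
      "integrable sphere_measure (\<lambda>x. f (T x)) \<longleftrightarrow> integrable sphere_measure f"
    and sphere_integral_orthogonal:
      "(LINT x|sphere_measure. f (T x)) = (LINT x|sphere_measure. f x)"
proof -
  have m: "U \<in> sphere_measure \<rightarrow>\<^sub>M sphere_measure" if "orthogonal_transformation U"
    for U :: "real^'n \<Rightarrow> real^'n"
    using orthogonal_borel_measurable[OF that]
    by (simp add: sphere_measure_def measurable_def space_scale_measure)
  note pres = m[OF T] m[OF orthogonal_transformation_inv[OF T]]
    orthogonal_inv(1)[OF T] sphere_measure_orthogonal[OF T]
  show "integrable sphere_measure (\<lambda>x. f (T x)) \<longleftrightarrow> integrable sphere_measure f"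
    by (rule measure_preserving_integrable_iff[OF pres])
  show "(LINT x|sphere_measure. f (T x)) = (LINT x|sphere_measure. f x)"
    by (rule measure_preserving_integral[OF pres])
qed

section \<open>Orthogonal change of variables for smooth functions\<close>

lemma grad_unique:
  fixes f :: "real^'n \<Rightarrow> real"
  assumes "(f has_derivative (\<lambda>h. v \<bullet> h)) (at x)"
  shows "grad f x = v"
  by (simp add: grad_def vec_eq_iff inner_axis frechet_derivative_at[OF assms, symmetric])

lemma has_derivative_grad:
  fixes f :: "real^'n \<Rightarrow> real"
  assumes "f differentiable (at x)"
  shows "(f has_derivative (\<lambda>h. grad f x \<bullet> h)) (at x)"
proof -
  let ?F = "frechet_derivative f (at x)"
  have der: "(f has_derivative ?F) (at x)"
    using assms by (simp add: frechet_derivative_works)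
  then have lin: "linear ?F" by (rule has_derivative_linear)
  have "?F h = grad f x \<bullet> h" for h
  proof -
    have "?F h = ?F (\<Sum>i\<in>UNIV. h $ i *\<^sub>R axis i 1)"
      by (simp only: basis_expansion scalar_mult_eq_scaleR[symmetric])
    also have "\<dots> = (\<Sum>i\<in>UNIV. h $ i * ?F (axis i 1))"
      using lin by (simp add: linear_sum linear_scale)
    finally show ?thesis by (simp add: grad_def inner_vec_def mult.commute)
  qed
  with der show ?thesis by (metis ext)
qed

lemma grad_compose_orthogonal:
  fixes T :: "real^'n \<Rightarrow> real^'n" and f :: "real^'n \<Rightarrow> real"
  assumes T: "orthogonal_transformation T" and f: "f differentiable (at (T x))"
  shows "(\<lambda>x. f (T x)) differentiable (at x)"
    and "grad (\<lambda>x. f (T x)) x = inv T (grad f (T x))"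
proof -
  have "(T has_derivative T) (at x)"
    using orthogonal_bounded_linear[OF T] by (rule bounded_linear_imp_has_derivative)
  from has_derivative_compose[OF this has_derivative_grad[OF f]]
  have "((\<lambda>x. f (T x)) has_derivative (\<lambda>h. inv T (grad f (T x)) \<bullet> h)) (at x)"
    by (simp add: orthogonal_inner_shift[OF T])
  then show "(\<lambda>x. f (T x)) differentiable (at x)"
    "grad (\<lambda>x. f (T x)) x = inv T (grad f (T x))"
    unfolding differentiable_def by (blast, rule grad_unique)
qed

text \<open>
  By the chain rule the partial derivatives of \<open>f \<circ> T\<close> are fixed linear combinations of those of \<open>f\<close>,
  composed with \<open>T\<close>. The closure of \<open>C\<^sup>k\<close> under linear combinations therefore drives the induction on
  \<open>k\<close> in \<open>Ck_compose_orthogonal\<close>.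
\<close>

lemma Ck_cmult: "Ck k f \<Longrightarrow> Ck k (\<lambda>x. c * f x)"
proof (induction k arbitrary: f)
  case 0
  then show ?case by (auto intro: continuous_intros)
next
  case (Suc k)
  have "grad (\<lambda>x. c * f x) x = c *\<^sub>R grad f x" for x
    using has_derivative_mult_right[OF has_derivative_grad[of f x], of c] Suc.prems
    by (intro grad_unique) simp
  moreover have "(\<lambda>x. c * f x) differentiable (at x)" for x
    using Suc.prems by (intro differentiable_mult) simp_all
  moreover have "Ck k (\<lambda>x. c * grad f x $ i)" for i
    using Suc.prems by (intro Suc.IH) simp
  ultimately show ?case by simp
qed

lemma Ck_add: "Ck k f \<Longrightarrow> Ck k g \<Longrightarrow> Ck k (\<lambda>x. f x + g x)"
proof (induction k arbitrary: f g)
  case 0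
  then show ?case by (auto intro: continuous_intros)
next
  case (Suc k)
  have "grad (\<lambda>x. f x + g x) x = grad f x + grad g x" for x
    using has_derivative_add[OF has_derivative_grad[of f x] has_derivative_grad[of g x]] Suc.prems
    by (intro grad_unique) (simp add: inner_add_left)
  moreover have "(\<lambda>x. f x + g x) differentiable (at x)" for x
    using Suc.prems by (intro differentiable_add) simp_all
  moreover have "Ck k (\<lambda>x. grad f x $ i + grad g x $ i)" for i
    using Suc.prems by (intro Suc.IH) simp_all
  ultimately show ?case by simp
qed

lemma Ck_zero: "Ck k (\<lambda>x::real^'n. 0)"
proof (induction k)
  case (Suc k)
  have "grad (\<lambda>x::real^'n. 0) x = 0" for x :: "real^'n"
    by (rule grad_unique) simp
  with Suc show ?case by simp
qed simp

lemma Ck_sum: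
  assumes "finite I" "\<And>i. i \<in> I \<Longrightarrow> Ck k (f i)"
  shows "Ck k (\<lambda>x. \<Sum>i\<in>I. f i x)"
  using assms by (induction I rule: finite_induct) (auto intro: Ck_zero Ck_add)

lemma Ck_compose_orthogonal:
  fixes T :: "real^'n \<Rightarrow> real^'n"
  assumes T: "orthogonal_transformation T"
  shows "Ck k f \<Longrightarrow> Ck k (\<lambda>x. f (T x))"
proof (induction k arbitrary: f)
  case 0
  then show ?case
    using continuous_on_compose2[of UNIV f UNIV T] linear_continuous_on[OF orthogonal_bounded_linear[OF T]]
    by simp
next
  case (Suc k)
  have "grad (\<lambda>x. f (T x)) x $ i = (\<Sum>j\<in>UNIV. T (axis i 1) $ j * grad f (T x) $ j)" for x i
  proof -
    have "grad (\<lambda>x. f (T x)) x $ i = inv T (grad f (T x)) \<bullet> axis i 1"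
      using Suc.prems by (simp add: grad_compose_orthogonal[OF T] inner_axis)
    also have "\<dots> = grad f (T x) \<bullet> T (axis i 1)"
      by (simp add: orthogonal_inner_shift[OF T])
    finally show ?thesis by (simp add: inner_vec_def mult.commute)
  qed
  moreover have "Ck k (\<lambda>x. \<Sum>j\<in>UNIV. T (axis i 1) $ j * grad f (T x) $ j)" for i
  proof (rule Ck_sum)
    fix j
    have "Ck k (\<lambda>x. grad f x $ j)" using Suc.prems by simp
    from Suc.IH[OF this] show "Ck k (\<lambda>x. T (axis i 1) $ j * grad f (T x) $ j)"
      by (rule Ck_cmult)
  qed simp
  moreover have "(\<lambda>x. f (T x)) differentiable (at x)" for x
    using Suc.prems by (intro grad_compose_orthogonal[OF T]) simp
  ultimately show ?case by simp
qed

lemma smooth_compose_orthogonal: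
  fixes T :: "real^'n \<Rightarrow> real^'n"
  assumes "orthogonal_transformation T" "smooth f"
  shows "smooth (\<lambda>x. f (T x))"
  using assms by (simp add: smooth_def Ck_compose_orthogonal)

lemma smooth_differentiable: "smooth f \<Longrightarrow> f differentiable (at x)"
  unfolding smooth_def by (metis Ck.simps(2))

lemma test_functions_compose_orthogonal:
  fixes T :: "real^'n \<Rightarrow> real^'n"
  assumes T: "orthogonal_transformation T" and \<phi>: "\<phi> \<in> test_functions \<Omega>"
  shows "(\<lambda>x. \<phi> (T x)) \<in> test_functions (T -` \<Omega>)"
proof -
  have vimage: "T -` A = inv T ` A" for A
    using orthogonal_transformation_bij[OF T] by (simp add: bij_vimage_eq_inv_image)
  have bl: "bounded_linear (inv T)"
    by (rule orthogonal_bounded_linear[OF orthogonal_transformation_inv[OF T]])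
  have "{x. \<phi> (T x) \<noteq> 0} = inv T ` {x. \<phi> x \<noteq> 0}"
    unfolding vimage[symmetric] by auto
  then have "closure {x. \<phi> (T x) \<noteq> 0} = inv T ` closure {x. \<phi> x \<noteq> 0}"
    using closure_injective_linear_image[of "inv T" "{x. \<phi> x \<noteq> 0}"]
      orthogonal_transformation_inv[OF T]
    by (simp add: orthogonal_transformation_linear orthogonal_transformation_inj)
  moreover have "compact (inv T ` closure {x. \<phi> x \<noteq> 0})"
    using \<phi> bl by (intro compact_continuous_image linear_continuous_on) (simp_all add: test_functions_def)
  moreover have "inv T ` closure {x. \<phi> x \<noteq> 0} \<subseteq> inv T ` \<Omega>"
    using \<phi> by (intro image_mono) (simp add: test_functions_def)
  moreover have "smooth (\<lambda>x. \<phi> (T x))"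
    using \<phi> by (intro smooth_compose_orthogonal[OF T]) (simp add: test_functions_def)
  ultimately show ?thesis
    unfolding test_functions_def vimage by (simp only: mem_Collect_eq simp_thms)
qed

text \<open>
  Transporting an integral identity to \<open>T -` \<Omega>\<close> means testing it with \<open>\<phi>\<close> on \<open>T -` \<Omega>\<close>; the given identity
  on \<open>\<Omega>\<close> is then used with \<open>\<psi> = \<phi> \<circ> T\<inverse>\<close>.
\<close>

lemma test_functions_orthogonal_cases:
  fixes T :: "real^'n \<Rightarrow> real^'n"
  assumes T: "orthogonal_transformation T" and \<phi>: "\<phi> \<in> test_functions (T -` \<Omega>)"
  obtains \<psi> where "\<psi> \<in> test_functions \<Omega>" "\<And>x. \<phi> x = \<psi> (T x)"
    "\<And>x. grad \<phi> x = inv T (grad \<psi> (T x))"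
proof -
  define \<psi> where "\<psi> = (\<lambda>x. \<phi> (inv T x))"
  have "inv T -` (T -` \<Omega>) = \<Omega>"
    by (auto simp: orthogonal_inv[OF T])
  then have \<psi>: "\<psi> \<in> test_functions \<Omega>"
    using test_functions_compose_orthogonal[OF orthogonal_transformation_inv[OF T] \<phi>]
    by (simp add: \<psi>_def)
  have \<phi>\<psi>: "\<phi> = (\<lambda>x. \<psi> (T x))"
    by (simp add: \<psi>_def orthogonal_inv[OF T])
  have "grad \<phi> x = inv T (grad \<psi> (T x))" for x
    unfolding \<phi>\<psi> using \<psi> by (intro grad_compose_orthogonal[OF T] smooth_differentiable)
      (simp add: test_functions_def)
  with \<psi> \<phi>\<psi> show thesis by (intro that[of \<psi>]) auto
qed

section \<open>Orthogonal change of variables for weak derivatives and traces\<close>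

text \<open>
  Since \<open>T\<close> is invertible, the bounded linear map \<open>T\<inverse>\<close> may be pulled out of an integral even if the
  integral does not converge: then both sides are 0.
\<close>

lemma set_integral_inv_orthogonal:
  fixes T :: "real^'n \<Rightarrow> real^'n"
  assumes T: "orthogonal_transformation T"
  shows "(LINT x:A|M. inv T (f x)) = inv T (LINT x:A|M. f x)"
proof -
  have bl: "bounded_linear T" "bounded_linear (inv T)"
    using orthogonal_bounded_linear[OF T]
      orthogonal_bounded_linear[OF orthogonal_transformation_inv[OF T]] by auto
  have "(LINT x|M. inv T (indicat_real A x *\<^sub>R f x)) = inv T (LINT x|M. indicat_real A x *\<^sub>R f x)"
    by (rule integral_bounded_linear'[OF bl(2,1)]) (simp add: orthogonal_inv[OF T])
  then show ?thesis
    by (simp add: set_lebesgue_integral_def linear_scale[OF bounded_linear.linear[OF bl(2)]])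
qed

lemma set_integrable_inv_orthogonal:
  fixes T :: "real^'n \<Rightarrow> real^'n"
  assumes T: "orthogonal_transformation T" and f: "set_integrable M A f"
  shows "set_integrable M A (\<lambda>x. inv T (f x))"
proof -
  have bl: "bounded_linear (inv T)"
    by (rule orthogonal_bounded_linear[OF orthogonal_transformation_inv[OF T]])
  show ?thesis
    using integrable_bounded_linear[OF bl] f
    by (force simp: set_integrable_def linear_scale[OF bounded_linear.linear[OF bl]])
qed

lemma locally_integrable_on_orthogonal:
  fixes T :: "real^'n \<Rightarrow> real^'n"
  assumes T: "orthogonal_transformation T" and f: "locally_integrable_on f \<Omega>"
  shows "locally_integrable_on (\<lambda>x. f (T x)) (T -` \<Omega>)"
  unfolding locally_integrable_on_def
proof (intro allI impI)
  fix K assume K: "compact K \<and> K \<subseteq> T -` \<Omega>"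
  then have "compact (T ` K)"
    using orthogonal_bounded_linear[OF T]
    by (intro compact_continuous_image linear_continuous_on) auto
  with K f have "set_integrable lebesgue (T ` K) f"
    by (auto simp: locally_integrable_on_def image_subset_iff_subset_vimage)
  moreover have "T -` (T ` K) = K"
    using orthogonal_transformation_inj[OF T] by (rule inj_vimage_image_eq)
  ultimately show "set_integrable lebesgue K (\<lambda>x. f (T x))"
    using set_integrable_orthogonal[OF T, of "T ` K" f] by simp
qed

text \<open>
  The weak gradient obeys the classical chain rule \<open>\<nabla>(u \<circ> T) = T\<inverse> (\<nabla>u \<circ> T)\<close>, where \<open>T\<inverse>\<close> is the transpose
  of \<open>T\<close>. Writing a test function as \<open>\<phi> = \<psi> \<circ> T\<close>, both sides of the defining identity are \<open>T\<inverse>\<close> applied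
  to the corresponding sides of the identity for \<open>u\<close> and \<open>\<psi>\<close>.
\<close>

lemma has_weak_gradient_orthogonal:
  fixes T :: "real^'n \<Rightarrow> real^'n"
  assumes T: "orthogonal_transformation T" and u: "has_weak_gradient u g \<Omega>"
  shows "has_weak_gradient (\<lambda>x. u (T x)) (\<lambda>x. inv T (g (T x))) (T -` \<Omega>)"
  unfolding has_weak_gradient_def
proof (intro conjI ballI)
  show "locally_integrable_on (\<lambda>x. u (T x)) (T -` \<Omega>)"
    using u by (auto simp: has_weak_gradient_def intro: locally_integrable_on_orthogonal[OF T])
  have "locally_integrable_on (\<lambda>x. g (T x)) (T -` \<Omega>)"
    using u by (auto simp: has_weak_gradient_def intro: locally_integrable_on_orthogonal[OF T])
  then show "locally_integrable_on (\<lambda>x. inv T (g (T x))) (T -` \<Omega>)"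
    by (auto simp: locally_integrable_on_def intro: set_integrable_inv_orthogonal[OF T])
  fix \<phi> assume "\<phi> \<in> test_functions (T -` \<Omega>)"
  then obtain \<psi> where \<psi>: "\<psi> \<in> test_functions \<Omega>" "\<And>x. \<phi> x = \<psi> (T x)"
    "\<And>x. grad \<phi> x = inv T (grad \<psi> (T x))"
    using test_functions_orthogonal_cases[OF T] by metis
  have scale: "c *\<^sub>R inv T y = inv T (c *\<^sub>R y)" for c y
    using orthogonal_transformation_inv[OF T] by (simp add: linear_scale orthogonal_transformation_linear)
  have neg: "inv T (- y) = - inv T y" for y
    using orthogonal_transformation_inv[OF T] by (simp add: linear_neg orthogonal_transformation_linear)
  have "(LINT x:T -` \<Omega>|lebesgue. u (T x) *\<^sub>R grad \<phi> x)
      = inv T (LINT x:T -` \<Omega>|lebesgue. u (T x) *\<^sub>R grad \<psi> (T x))"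
    by (simp only: \<psi>(3) scale set_integral_inv_orthogonal[OF T])
  also have "\<dots> = inv T (LINT x:\<Omega>|lebesgue. u x *\<^sub>R grad \<psi> x)"
    by (simp only: set_integral_orthogonal[OF T, of \<Omega> "\<lambda>x. u x *\<^sub>R grad \<psi> x"])
  also have "\<dots> = - inv T (LINT x:\<Omega>|lebesgue. \<psi> x *\<^sub>R g x)"
    using u \<psi>(1) by (simp add: has_weak_gradient_def neg)
  also have "\<dots> = - inv T (LINT x:T -` \<Omega>|lebesgue. \<psi> (T x) *\<^sub>R g (T x))"
    by (simp only: set_integral_orthogonal[OF T, of \<Omega> "\<lambda>x. \<psi> x *\<^sub>R g x"])
  also have "\<dots> = - (LINT x:T -` \<Omega>|lebesgue. \<phi> x *\<^sub>R inv T (g (T x)))"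
    by (simp only: \<psi>(2) scale set_integral_inv_orthogonal[OF T])
  finally show "(LINT x:T -` \<Omega>|lebesgue. u (T x) *\<^sub>R grad \<phi> x)
      = - (LINT x:T -` \<Omega>|lebesgue. \<phi> x *\<^sub>R inv T (g (T x)))" .
qed

lemma Lp_orthogonal:
  fixes T :: "real^'n \<Rightarrow> real^'n"
  assumes T: "orthogonal_transformation T" and f: "f \<in> Lp p \<Omega>"
  shows "(\<lambda>x. f (T x)) \<in> Lp p (T -` \<Omega>)"
  using f set_borel_measurable_orthogonal[OF T, of \<Omega> f]
    set_integrable_orthogonal[OF T, of \<Omega> "\<lambda>x. norm (f x) powr p"]
  by (simp add: Lp_def)

lemma Lp_inv_orthogonal:
  fixes T :: "real^'n \<Rightarrow> real^'n"
  assumes T: "orthogonal_transformation T" and f: "f \<in> Lp p \<Omega>"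
  shows "(\<lambda>x. inv T (f x)) \<in> Lp p \<Omega>"
proof -
  have T': "orthogonal_transformation (inv T)" by (rule orthogonal_transformation_inv[OF T])
  have "(\<lambda>x. inv T (indicat_real \<Omega> x *\<^sub>R f x)) \<in> borel_measurable lebesgue"
    using f by (intro measurable_compose[OF _ orthogonal_borel_measurable[OF T']])
      (simp add: Lp_def set_borel_measurable_def)
  then show ?thesis
    using f by (simp add: Lp_def set_borel_measurable_def orthogonal_transformation_norm[OF T']
        linear_scale[OF orthogonal_transformation_linear[OF T']])
qed

lemma W1_orthogonal:
  fixes T :: "real^'n \<Rightarrow> real^'n"
  assumes T: "orthogonal_transformation T" and u: "u \<in> W1 p \<Omega>"
  shows "(\<lambda>x. u (T x)) \<in> W1 p (T -` \<Omega>)"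
proof -
  obtain g where "u \<in> Lp p \<Omega>" and g: "has_weak_gradient u g \<Omega>" "g \<in> Lp p \<Omega>"
    using u by (auto simp: W1_def)
  then have "(\<lambda>x. u (T x)) \<in> Lp p (T -` \<Omega>)"
    by (intro Lp_orthogonal[OF T])
  moreover have "(\<lambda>x. inv T (g (T x))) \<in> Lp p (T -` \<Omega>)"
    by (intro Lp_inv_orthogonal[OF T] Lp_orthogonal[OF T] g)
  ultimately show ?thesis
    using has_weak_gradient_orthogonal[OF T g(1)] unfolding W1_def by blast
qed

lemma orthogonal_vimage_ball_0:
  fixes T :: "real^'n \<Rightarrow> real^'n"
  assumes T: "orthogonal_transformation T"
  shows "T -` ball 0 r = ball 0 r"
  using T by (auto simp: orthogonal_transformation_norm)

text \<open>
  If smooth \<open>v\<^sub>k\<close> approximate \<open>u\<close> up to the boundary, then the smooth functions \<open>v\<^sub>k \<circ> T\<close> approximate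
  \<open>u \<circ> T\<close>: all three error integrals keep their values.
\<close>

lemma has_trace_orthogonal:
  fixes T :: "real^'n \<Rightarrow> real^'n"
  assumes T: "orthogonal_transformation T" and u: "has_trace u h"
  shows "has_trace (\<lambda>x. u (T x)) (\<lambda>x. h (T x))"
proof -
  note ball = orthogonal_vimage_ball_0[OF T, of 1]
  obtain g v where h: "integrable sphere_measure h" and uL: "u \<in> Lp 1 (ball 0 1)"
    and g: "has_weak_gradient u g (ball 0 1)" "g \<in> Lp 1 (ball 0 1)"
    and v: "\<And>k. smooth (v k)"
    and lim: "(\<lambda>k. LINT x:ball 0 1|lebesgue. \<bar>v k x - u x\<bar>) \<longlonglongrightarrow> 0"
      "(\<lambda>k. LINT x:ball 0 1|lebesgue. norm (grad (v k) x - g x)) \<longlonglongrightarrow> 0"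
      "(\<lambda>k. LINT x|sphere_measure. \<bar>v k x - h x\<bar>) \<longlonglongrightarrow> 0"
    using u unfolding has_trace_def by blast
  let ?v = "\<lambda>k x. v k (T x)" and ?g = "\<lambda>x. inv T (g (T x))"
  have T': "orthogonal_transformation (inv T)" by (rule orthogonal_transformation_inv[OF T])
  have grad: "norm (grad (?v k) x - ?g x) = norm (grad (v k) (T x) - g (T x))" for k x
    using grad_compose_orthogonal(2)[OF T smooth_differentiable[OF v]]
    by (simp add: orthogonal_transformation_norm[OF T']
        linear_diff[OF orthogonal_transformation_linear[OF T'], symmetric])
  have "(\<lambda>k. LINT x:ball 0 1|lebesgue. \<bar>?v k x - u (T x)\<bar>) \<longlonglongrightarrow> 0"
    using lim(1) set_integral_orthogonal[OF T, of "ball 0 1" "\<lambda>x. \<bar>v k x - u x\<bar>" for k]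
    by (simp add: ball)
  moreover have "(\<lambda>k. LINT x:ball 0 1|lebesgue. norm (grad (?v k) x - ?g x)) \<longlonglongrightarrow> 0"
    using lim(2) set_integral_orthogonal[OF T, of "ball 0 1" "\<lambda>x. norm (grad (v k) x - g x)" for k]
    by (simp add: ball grad)
  moreover have "(\<lambda>k. LINT x|sphere_measure. \<bar>?v k x - h (T x)\<bar>) \<longlonglongrightarrow> 0"
    using lim(3) sphere_integral_orthogonal[OF T, of "\<lambda>x. \<bar>v k x - h x\<bar>" for k] by simp
  moreover have "has_weak_gradient (\<lambda>x. u (T x)) ?g (ball 0 1)"
    using has_weak_gradient_orthogonal[OF T g(1)] by (simp add: ball)
  moreover have "?g \<in> Lp 1 (ball 0 1)"
    using Lp_inv_orthogonal[OF T Lp_orthogonal[OF T g(2)]] by (simp add: ball)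
  moreover have "(\<lambda>x. u (T x)) \<in> Lp 1 (ball 0 1)"
    using Lp_orthogonal[OF T uL] by (simp add: ball)
  moreover have "\<And>k. smooth (?v k)"
    by (rule smooth_compose_orthogonal[OF T v])
  ultimately show ?thesis
    using h unfolding has_trace_def sphere_integrable_orthogonal[OF T]
    by (intro conjI exI[of _ ?g] exI[of _ ?v] allI)
qed

section \<open>Symmetry of the Green's function\<close>

text \<open>
  Composition with \<open>T\<close> moves the pole from \<open>T y\<close> to \<open>y\<close>. The Dirichlet form is unchanged because \<open>T\<close>
  preserves inner products, and the drift term because the drift is equivariant:
  \<open>b(x) \<bullet> T\<inverse> \<nabla>u(T x) = T(b(x)) \<bullet> \<nabla>u(T x) = b(T x) \<bullet> \<nabla>u(T x)\<close>.
\<close>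

lemma greens_at_pole_orthogonal:
  fixes T :: "real^'n \<Rightarrow> real^'n"
  assumes T: "orthogonal_transformation T" and b: "\<And>x. b (T x) = T (b x)"
    and u: "greens_at_pole b (T y) u"
  shows "greens_at_pole b y (\<lambda>x. u (T x))"
proof -
  note ball = orthogonal_vimage_ball_0[OF T, of 1]
  have "continuous_on (ball 0 1 - ball y s) (\<lambda>x. u (T x))" if "s > 0" for s
  proof (rule continuous_on_compose2[where t = "ball 0 1 - ball (T y) s"])
    show "continuous_on (ball 0 1 - ball (T y) s) u"
      using u that by (simp add: greens_at_pole_def)
    show "continuous_on (ball 0 1 - ball y s) T"
      using orthogonal_bounded_linear[OF T] by (rule linear_continuous_on)
    show "T ` (ball 0 1 - ball y s) \<subseteq> ball 0 1 - ball (T y) s"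
      using orthogonal_vimage_ball(1)[OF T, of y s] ball by blast
  qed
  moreover have "(\<lambda>x. u (T x)) \<in> W1 2 (ball 0 1 - cball y s)" if "s > 0" for s
  proof -
    have "u \<in> W1 2 (ball 0 1 - cball (T y) s)"
      using u that by (simp add: greens_at_pole_def)
    from W1_orthogonal[OF T this] show ?thesis
      by (simp only: vimage_Diff ball orthogonal_vimage_ball[OF T])
  qed
  moreover have "(\<lambda>x. u (T x)) \<in> W1 1 (ball 0 1)"
    using u W1_orthogonal[OF T, of u 1 "ball 0 1"] by (simp add: greens_at_pole_def ball)
  moreover have "has_trace (\<lambda>x. u (T x)) (\<lambda>x. 0)"
    using u has_trace_orthogonal[OF T, of u "\<lambda>x. 0"] by (simp add: greens_at_pole_def)
  moreover have "\<exists>g. has_weak_gradient (\<lambda>x. u (T x)) g (ball 0 1) \<and> g \<in> Lp 1 (ball 0 1) \<and>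
      (\<forall>\<phi>\<in>test_functions (ball 0 1).
        (LINT x:ball 0 1|lebesgue. g x \<bullet> grad \<phi> x + (b x \<bullet> g x) * \<phi> x) = \<phi> y)"
  proof -
    obtain g where g: "has_weak_gradient u g (ball 0 1)" "g \<in> Lp 1 (ball 0 1)"
      and eq: "\<And>\<phi>. \<phi> \<in> test_functions (ball 0 1) \<Longrightarrow>
        (LINT x:ball 0 1|lebesgue. g x \<bullet> grad \<phi> x + (b x \<bullet> g x) * \<phi> x) = \<phi> (T y)"
      using u unfolding greens_at_pole_def by blast
    let ?g = "\<lambda>x. inv T (g (T x))"
    have "(LINT x:ball 0 1|lebesgue. ?g x \<bullet> grad \<phi> x + (b x \<bullet> ?g x) * \<phi> x) = \<phi> y"
      if \<phi>: "\<phi> \<in> test_functions (ball 0 1)" for \<phi>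
    proof -
      obtain \<psi> where \<psi>: "\<psi> \<in> test_functions (ball 0 1)" "\<And>x. \<phi> x = \<psi> (T x)"
        "\<And>x. grad \<phi> x = inv T (grad \<psi> (T x))"
        using test_functions_orthogonal_cases[OF T, of \<phi> "ball 0 1"] \<phi> by (metis ball)
      have "?g x \<bullet> grad \<phi> x = g (T x) \<bullet> grad \<psi> (T x)" for x
        by (simp add: \<psi>(3) orthogonal_inner_shift[OF T, symmetric] orthogonal_inv[OF T])
      moreover have "b x \<bullet> ?g x = b (T x) \<bullet> g (T x)" for x
        using orthogonal_inner_shift[OF T, of "g (T x)" "b x"] by (simp add: b inner_commute)
      ultimately have "(LINT x:ball 0 1|lebesgue. ?g x \<bullet> grad \<phi> x + (b x \<bullet> ?g x) * \<phi> x)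
          = (LINT x:ball 0 1|lebesgue. g x \<bullet> grad \<psi> x + (b x \<bullet> g x) * \<psi> x)"
        using set_integral_orthogonal[OF T, of "ball 0 1"
            "\<lambda>x. g x \<bullet> grad \<psi> x + (b x \<bullet> g x) * \<psi> x"] by (simp add: ball \<psi>(2))
      then show ?thesis by (simp add: eq[OF \<psi>(1)] \<psi>(2))
    qed
    then show ?thesis
      using has_weak_gradient_orthogonal[OF T g(1)] Lp_inv_orthogonal[OF T Lp_orthogonal[OF T g(2)]]
      by (intro exI[of _ ?g]) (simp add: ball)
  qed
  ultimately show ?thesis by (simp add: greens_at_pole_def)
qed

lemma greens_conditions_orthogonal:
  fixes T :: "real^'n \<Rightarrow> real^'n"
  assumes T: "orthogonal_transformation T" and b: "\<And>x. b (T x) = T (b x)"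
    and G: "greens_conditions b G"
  shows "greens_conditions b (\<lambda>x y. G (T x) (T y))"
proof -
  have "T x \<in> ball 0 1 \<longleftrightarrow> x \<in> ball 0 1" for x
    by (simp add: orthogonal_transformation_norm[OF T])
  moreover have "T x = T y \<longleftrightarrow> x = y" for x y
    using orthogonal_transformation_inj[OF T] by (simp add: inj_eq)
  moreover have "greens_at_pole b y (\<lambda>x. real_of_ereal (G (T x) (T y)))"
    if "T y \<in> ball 0 1" for y
    using G that by (intro greens_at_pole_orthogonal[of T b, OF T b]) (simp_all add: greens_conditions_def)
  ultimately show ?thesis
    using G by (simp add: greens_conditions_def)
qed

text \<open>
  The function \<open>(x, y) \<mapsto> G(T x, T y)\<close> satisfies the conditions that characterize \<open>G\<close>, so the uniqueness
  of the Green's function identifies the two.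
\<close>

lemma greens_function_orthogonal:
  fixes T :: "real^'n \<Rightarrow> real^'n"
  assumes T: "orthogonal_transformation T" and b: "\<And>x. b (T x) = T (b x)"
    and G: "is_greens_function b G" and "x \<in> ball 0 1" "y \<in> ball 0 1" "x \<noteq> y"
  shows "G (T x) (T y) = G x y"
  using assms greens_conditions_orthogonal[of T b G, OF T b] unfolding is_greens_function_def by blast

text \<open>
  The drift is a radial vector field, that is, a function of \<open>|x|\<close> times \<open>x\<close>.
\<close>

lemma drift_orthogonal:
  fixes T :: "real^'n \<Rightarrow> real^'n"
  assumes T: "orthogonal_transformation T"
  shows "drift C m (T x) = T (drift C m x)"
  using orthogonal_transformation_linear[OF T] orthogonal_transformation_norm[OF T, of x]
  by (simp add: drift_def linear_scale linear_neg)

theorem theorem3: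
  fixes G :: "real^'n \<Rightarrow> real^'n \<Rightarrow> ereal" and C :: real and m :: nat
  assumes "CARD('n) \<ge> 3" and "C \<ge> 1" and "m \<ge> 100"
    and "is_greens_function (drift C m) G"
  shows "\<forall>x\<in>ball 0 1 - {0}. \<forall>x'\<in>ball 0 1 - {0}. norm x = norm x' \<longrightarrow> G x 0 = G x' 0"
proof (intro ballI impI)
  fix x x' :: "real^'n"
  assume x: "x \<in> ball 0 1 - {0}" and "norm x = norm x'"
  then obtain T :: "real^'n \<Rightarrow> real^'n" where T: "orthogonal_transformation T" "T x = x'"
    using orthogonal_transformation_exists by blast
  have "T 0 = 0"
    using orthogonal_transformation_linear[OF T(1)] by (rule linear_0)
  \<comment> \<open>The origin is a fixed point of \<open>T\<close>, so the pole stays where it is.\<close>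
  then show "G x 0 = G x' 0"
    using greens_function_orthogonal[of T "drift C m" G x 0, OF T(1) drift_orthogonal[OF T(1)] assms(4)] x T(2)
    by simp
qed

end
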